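(* Let $\mathcal{S}$ be a structural abstract logic which is both uniform and couniform in a propositional language $\mathcal{L}$ with $\mathrm{card}(\mathcal{V}_{\mathcal{L}})\ge\aleph_0$, and let $\mathcal{L}^{+}$ be a primitive extension of $\mathcal{L}$. Then $\mathcal{S}$ and $(\mathcal{S})^{+}$ are determined by one and the same atlas which is both uniform and couniform.
   Context: A propositional language $\mathcal{L}$ has a set $\mathcal{V}_{\mathcal{L}}$ of variables, a set $\mathcal{C}_{\mathcal{L}}$ of constants and a set $\mathcal{F}_{\mathcal{L}}$ of finitary connectives. $\mathbf{Fm}_{\mathcal{L}}$ is the set of all $\mathcal{L}$-formulae; $\mathcal{V}(\alpha)$ is the set of variables occurring in $\alpha$, and $\mathcal{V}(X)=\bigcup_{\alpha\in X}\mathcal{V}(\alpha)$ for a set $X$ of formulae. For $\mathcal{V}\subseteq\mathcal{V}_{\mathcal{L}}$, $\mathbf{Fm}_{\mathcal{L}}[\mathcal{V}]=\{\alpha\in\mathbf{Fm}_{\mathcal{L}} : \mathcal{V}(\alpha)\subseteq\mathcal{V}\}$. $\mathcal{L}^{+}$ is a primitive extension of $\mathcal{L}$ if $\mathcal{C}_{\mathcal{L}}\cup\mathcal{F}_{\mathcal{L}}=\mathcal{C}_{\mathcal{L}^{+}}\cup\mathcal{F}_{\mathcal{L}^{+}}$ and $\mathcal{V}_{\mathcal{L}}\subseteq\mathcal{V}_{\mathcal{L}^{+}}$. A structural abstract logic $\mathcal{S}$ in $\mathcal{L}$ is given by a (not necessarily finitary) consequence relation $\vdash_{\mathcal{S}}$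 on $\mathbf{Fm}_{\mathcal{L}}$ (reflexive, monotone, closed under cut) that is closed under substitutions; $\mathbf{Cn}_{\mathcal{S}}(X)=\{\alpha : X\vdash_{\mathcal{S}}\alpha\}$, and $X$ is consistent if $\mathbf{Cn}_{\mathcal{S}}(X)\neq\mathbf{Fm}_{\mathcal{L}}$. - $\mathcal{S}$ is uniform if for all $X,Y\subseteq\mathbf{Fm}_{\mathcal{L}}$ and $\alpha\in\mathbf{Fm}_{\mathcal{L}}$ with $\mathcal{V}(X\cup\{\alpha\})\cap\mathcal{V}(Y)=\varnothing$ and $Y$ consistent: $X\cup Y\vdash_{\mathcal{S}}\alpha$ implies $X\vdash_{\mathcal{S}}\alpha$. - $\mathcal{S}$ is couniform if for any collection $\{X_i\}_{i\in I}$ of formula sets with $\mathcal{V}(X_i)\cap\mathcal{V}(X_{j})=\varnothing$ for $i\neq j$ and $\mathcal{V}(\bigcup_{i\in I}X_i)\neq\mathcal{V}_{\mathcal{L}}$: if $\bigcup_{i\in I}X_i$ is inconsistent, then at least one $X_i$ is inconsistent. The Wójcicki logic $(\mathcal{S})^{+}$ in $\mathcal{L}^{+}$ is given by the relation: for $X\cup\{\alpha\}\subseteq\mathbf{Fm}_{\mathcal{L}^{+}}$, $X\vdash_{(\mathcal{S})^{+}}\alpha$ iff there are a set $Y\cup\{\beta\}\subseteq\mathbf{Fm}_{\mathcal{L}}$ and an $\mathcal{L}^{+}$-substitution $\sigma$ such that $\sigma(Y)\subseteq X$, $\alpha=\sigma(\beta)$ and $Y\vdash_{\mathcal{S}}\beta$.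 An $\mathcal{L}$-matrix is a pair $\mathbf{M}=\langle\mathbf{A},D\rangle$ with $\mathbf{A}$ an algebra of the signature of $\mathcal{L}$ and $D\subseteq|\mathbf{A}|$ (its logical filter). An atlas is a pair $\langle\mathbf{A},\{D_i\}_{i\in I}\rangle$ with $I\neq\varnothing$ and each $D_i\subseteq|\mathbf{A}|$; put $\mathbf{M}_i=\langle\mathbf{A},D_i\rangle$. An abstract logic in a given language is determined by an atlas if its consequence relation coincides with the matrix consequence in that language relative to the atlas: $\alpha$ follows from $X$ iff for every $i\in I$ and every valuation $v$ of the formulae of that language in $\mathbf{A}$ (homomorphism from the formula algebra to $\mathbf{A}$), $v[X]\subseteq D_i$ implies $v[\alpha]\in D_i$. The following notions are defined with respect to a language $\mathcal{L}$. $\mathfrak{S}(\mathbf{M}_i)$ is the collection of all sets of the form $\{\alpha\in\mathbf{Fm}_{\mathcal{L}} : v[\alpha]\in D_i\}$, with $v$ an $\mathcal{L}$-valuation in $\mathbf{A}$. The atlas is uniform if for all $X,Y\subseteq\mathbf{Fm}_{\mathcal{L}}$ with $X\subseteq\mathbf{Fm}_{\mathcal{L}}[\mathcal{V}_{\mathcal{L}}\setminus\mathcal{V}(Y)]$, all $i,j\in I$, all $Z_i\in\mathfrak{S}(\mathbf{M}_i)$ and $Z_j\in\mathfrak{S}(\mathbf{M}_j)$, there are $k\in I$ and $Z_k\in\mathfrak{S}(\mathbf{M}_k)$ such that: if $X\subseteq Z_i$ and $Y\subseteq Z_j\subsetneq\mathbf{Fm}_{\mathcal{L}}$, then $Z_i\cap\mathbf{Fm}_{\mathcal{L}}[\mathcal{V}_{\mathcal{L}}\setminus\mathcal{V}(Y)]=Z_k\cap\mathbf{Fm}_{\mathcal{L}}[\mathcal{V}_{\mathcal{L}}\setminus\mathcal{V}(Y)]$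 and $Z_j\cap\mathbf{Fm}_{\mathcal{L}}[\mathcal{V}(Y)]\subseteq Z_k$. The atlas is couniform if for any collection $\{X_t\}_{t\in T}$ of subsets of $\mathbf{Fm}_{\mathcal{L}}$ with $\mathcal{V}(X_t)\cap\mathcal{V}(X_{t'})=\varnothing$ for $t\neq t'$ and $\mathcal{V}(\bigcup_{t\in T}X_t)\neq\mathcal{V}_{\mathcal{L}}$: if for every $t\in T$ there are $j\in I$ and $Z_j\in\mathfrak{S}(\mathbf{M}_j)$ with $X_t\subseteq Z_j\subsetneq\mathbf{Fm}_{\mathcal{L}}$, then there are $k\in I$ and $Z_k\in\mathfrak{S}(\mathbf{M}_k)$ with $\bigcup_{t\in T}X_t\subseteq Z_k\subsetneq\mathbf{Fm}_{\mathcal{L}}$.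
   Formalization: It is additionally assumed that the relation defining the Wójcicki logic (S)^+ is a consequence relation; cut can fail when L has more connectives than variables, and then no atlas determines it. The assumption follows from the conclusion, so no valid case is lost. *)

theory Defs
  imports Main
begin

unbundle cardinal_syntax

section \<open>Propositional languages and formulas\<close>

datatype (symbols_of: 'f, vars_of: 'v) fm = Var 'v | App 'f "('f, 'v) fm list"

text \<open>A constant is a symbol applied to the empty list. The arity is meaningful only on
  the symbols of the language.\<close>

record ('f, 'v) lang =
  Variables :: "'v set"
  Constants :: "'f set"
  Connectives :: "'f set"
  arity :: "'f \<Rightarrow> nat"

definition Symbols :: "('f, 'v) lang \<Rightarrow> 'f set" where
  "Symbols L = Constants L \<union> Connectives L"

definition language :: "('f, 'v) lang \<Rightarrow> bool" where
  "language L \<longleftrightarrow> (\<forall>c\<in>Constants L. arity L c = 0)"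

definition primitive_extension :: "('f, 'v) lang \<Rightarrow> ('f, 'v) lang \<Rightarrow> bool" where
  "primitive_extension L L' \<longleftrightarrow>
     language L' \<and> Symbols L = Symbols L' \<and> (\<forall>f\<in>Symbols L. arity L f = arity L' f) \<and>
     Variables L \<subseteq> Variables L'"

inductive_set Fm :: "('f, 'v) lang \<Rightarrow> ('f, 'v) fm set" for L where
  Fm_Var: "p \<in> Variables L \<Longrightarrow> Var p \<in> Fm L"
| Fm_App: "f \<in> Symbols L \<Longrightarrow> length ts = arity L f \<Longrightarrow> (\<And>t. t \<in> set ts \<Longrightarrow> t \<in> Fm L) \<Longrightarrow>
    App f ts \<in> Fm L"

definition VarsOf :: "('f, 'v) fm set \<Rightarrow> 'v set" where
  "VarsOf X = (\<Union>\<alpha>\<in>X. vars_of \<alpha>)"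

definition Fm_over :: "('f, 'v) lang \<Rightarrow> 'v set \<Rightarrow> ('f, 'v) fm set" where
  "Fm_over L V = {\<alpha> \<in> Fm L. vars_of \<alpha> \<subseteq> V}"

text \<open>A substitution is given by its restriction to the variables; \<open>subst s\<close> is its
  homomorphic extension.\<close>

primrec subst :: "('v \<Rightarrow> ('f, 'v) fm) \<Rightarrow> ('f, 'v) fm \<Rightarrow> ('f, 'v) fm" where
  "subst s (Var p) = s p"
| "subst s (App f ts) = App f (map (subst s) ts)"

definition substitution :: "('f, 'v) lang \<Rightarrow> ('v \<Rightarrow> ('f, 'v) fm) \<Rightarrow> bool" where
  "substitution L s \<longleftrightarrow> (\<forall>p\<in>Variables L. s p \<in> Fm L)"


section \<open>Abstract logics\<close>

text \<open>A consequence relation on \<open>Fm L\<close> is represented by a relation on the whole type of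
  formulas, of which only the part between subsets and elements of \<open>Fm L\<close> is ever used.\<close>

type_synonym ('f, 'v) conseq = "('f, 'v) fm set \<Rightarrow> ('f, 'v) fm \<Rightarrow> bool"

definition abstract_logic :: "('f, 'v) lang \<Rightarrow> ('f, 'v) conseq \<Rightarrow> bool" where
  "abstract_logic L S \<longleftrightarrow>
     (\<forall>X \<alpha>. X \<subseteq> Fm L \<longrightarrow> \<alpha> \<in> X \<longrightarrow> S X \<alpha>) \<and>
     (\<forall>X Y \<alpha>. Y \<subseteq> Fm L \<longrightarrow> \<alpha> \<in> Fm L \<longrightarrow> X \<subseteq> Y \<longrightarrow> S X \<alpha> \<longrightarrow> S Y \<alpha>) \<and>
     (\<forall>X Y \<alpha>. X \<subseteq> Fm L \<longrightarrow> Y \<subseteq> Fm L \<longrightarrow> \<alpha> \<in> Fm L \<longrightarrow>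
        (\<forall>\<beta>\<in>Y. S X \<beta>) \<longrightarrow> S (X \<union> Y) \<alpha> \<longrightarrow> S X \<alpha>)"

definition structural :: "('f, 'v) lang \<Rightarrow> ('f, 'v) conseq \<Rightarrow> bool" where
  "structural L S \<longleftrightarrow>
     (\<forall>s X \<alpha>. substitution L s \<longrightarrow> X \<subseteq> Fm L \<longrightarrow> \<alpha> \<in> Fm L \<longrightarrow> S X \<alpha> \<longrightarrow>
        S (subst s ` X) (subst s \<alpha>))"

definition Cn :: "('f, 'v) lang \<Rightarrow> ('f, 'v) conseq \<Rightarrow> ('f, 'v) fm set \<Rightarrow> ('f, 'v) fm set" where
  "Cn L S X = {\<alpha> \<in> Fm L. S X \<alpha>}"

definition consistent :: "('f, 'v) lang \<Rightarrow> ('f, 'v) conseq \<Rightarrow> ('f, 'v) fm set \<Rightarrow> bool" where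
  "consistent L S X \<longleftrightarrow> Cn L S X \<noteq> Fm L"

definition uniform_logic :: "('f, 'v) lang \<Rightarrow> ('f, 'v) conseq \<Rightarrow> bool" where
  "uniform_logic L S \<longleftrightarrow>
     (\<forall>X Y \<alpha>. X \<subseteq> Fm L \<longrightarrow> Y \<subseteq> Fm L \<longrightarrow> \<alpha> \<in> Fm L \<longrightarrow>
        VarsOf (X \<union> {\<alpha>}) \<inter> VarsOf Y = {} \<longrightarrow> consistent L S Y \<longrightarrow>
        S (X \<union> Y) \<alpha> \<longrightarrow> S X \<alpha>)"

text \<open>Families of formula sets with pairwise disjoint sets of variables, and avoiding some
  variable of the language. The family is given by the set \<open>XX\<close> of its members: this loses no
  generality, since the properties below depend only on the set of members and repeating a
  member (possible only if it has no variables) changes nothing. The empty family is allowed.\<close>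

definition separated :: "('f, 'v) lang \<Rightarrow> ('f, 'v) fm set set \<Rightarrow> bool" where
  "separated L XX \<longleftrightarrow>
     (\<forall>X\<in>XX. X \<subseteq> Fm L) \<and>
     (\<forall>X\<in>XX. \<forall>X'\<in>XX. X \<noteq> X' \<longrightarrow> VarsOf X \<inter> VarsOf X' = {}) \<and>
     VarsOf (\<Union>XX) \<noteq> Variables L"

definition couniform_logic :: "('f, 'v) lang \<Rightarrow> ('f, 'v) conseq \<Rightarrow> bool" where
  "couniform_logic L S \<longleftrightarrow>
     (\<forall>XX. separated L XX \<longrightarrow> \<not> consistent L S (\<Union>XX) \<longrightarrow> (\<exists>X\<in>XX. \<not> consistent L S X))"

definition wojcicki ::
  "('f, 'v) lang \<Rightarrow> ('f, 'v) lang \<Rightarrow> ('f, 'v) conseq \<Rightarrow> ('f, 'v) conseq" where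
  "wojcicki L L' S X \<alpha> \<longleftrightarrow>
     X \<subseteq> Fm L' \<and> \<alpha> \<in> Fm L' \<and>
     (\<exists>Y \<beta> s. Y \<subseteq> Fm L \<and> \<beta> \<in> Fm L \<and> substitution L' s \<and>
        subst s ` Y \<subseteq> X \<and> \<alpha> = subst s \<beta> \<and> S Y \<beta>)"


section \<open>Algebras, matrices and atlases\<close>

record ('f, 'a) alg =
  carrier :: "'a set"
  oper :: "'f \<Rightarrow> 'a list \<Rightarrow> 'a"

definition algebra :: "('f, 'v) lang \<Rightarrow> ('f, 'a) alg \<Rightarrow> bool" where
  "algebra L A \<longleftrightarrow> carrier A \<noteq> {} \<and>
     (\<forall>f\<in>Symbols L. \<forall>as. length as = arity L f \<longrightarrow> set as \<subseteq> carrier A \<longrightarrow>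
        oper A f as \<in> carrier A)"

definition valuation :: "('f, 'v) lang \<Rightarrow> ('f, 'a) alg \<Rightarrow> (('f, 'v) fm \<Rightarrow> 'a) \<Rightarrow> bool" where
  "valuation L A v \<longleftrightarrow>
     v ` Fm L \<subseteq> carrier A \<and>
     (\<forall>f\<in>Symbols L. \<forall>ts. length ts = arity L f \<longrightarrow> set ts \<subseteq> Fm L \<longrightarrow>
        v (App f ts) = oper A f (map v ts))"

record ('f, 'a, 'i) atlas =
  Alg :: "('f, 'a) alg"
  Index :: "'i set"
  Filter :: "'i \<Rightarrow> 'a set"

definition is_atlas :: "('f, 'v) lang \<Rightarrow> ('f, 'a, 'i) atlas \<Rightarrow> bool" where
  "is_atlas L \<A> \<longleftrightarrow> algebra L (Alg \<A>) \<and> Index \<A> \<noteq> {} \<and>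
     (\<forall>i\<in>Index \<A>. Filter \<A> i \<subseteq> carrier (Alg \<A>))"

definition atlas_conseq :: "('f, 'v) lang \<Rightarrow> ('f, 'a, 'i) atlas \<Rightarrow> ('f, 'v) conseq" where
  "atlas_conseq L \<A> X \<alpha> \<longleftrightarrow>
     (\<forall>i\<in>Index \<A>. \<forall>v. valuation L (Alg \<A>) v \<longrightarrow>
        v ` X \<subseteq> Filter \<A> i \<longrightarrow> v \<alpha> \<in> Filter \<A> i)"

definition determined_by :: "('f, 'v) lang \<Rightarrow> ('f, 'v) conseq \<Rightarrow> ('f, 'a, 'i) atlas \<Rightarrow> bool" where
  "determined_by L S \<A> \<longleftrightarrow>
     (\<forall>X \<alpha>. X \<subseteq> Fm L \<longrightarrow> \<alpha> \<in> Fm L \<longrightarrow> (S X \<alpha> \<longleftrightarrow> atlas_conseq L \<A> X \<alpha>))"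

text \<open>\<open>SS L \<A> i\<close> is \<open>\<SS>(M\<^sub>i)\<close>.\<close>

definition SS :: "('f, 'v) lang \<Rightarrow> ('f, 'a, 'i) atlas \<Rightarrow> 'i \<Rightarrow> ('f, 'v) fm set set" where
  "SS L \<A> i = {{\<alpha> \<in> Fm L. v \<alpha> \<in> Filter \<A> i} | v. valuation L (Alg \<A>) v}"

definition uniform_atlas :: "('f, 'v) lang \<Rightarrow> ('f, 'a, 'i) atlas \<Rightarrow> bool" where
  "uniform_atlas L \<A> \<longleftrightarrow>
     (\<forall>X Y. X \<subseteq> Fm L \<longrightarrow> Y \<subseteq> Fm L \<longrightarrow> X \<subseteq> Fm_over L (Variables L - VarsOf Y) \<longrightarrow>
       (\<forall>i\<in>Index \<A>. \<forall>j\<in>Index \<A>. \<forall>Zi\<in>SS L \<A> i. \<forall>Zj\<in>SS L \<A> j.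
         \<exists>k\<in>Index \<A>. \<exists>Zk\<in>SS L \<A> k.
           X \<subseteq> Zi \<and> Y \<subseteq> Zj \<and> Zj \<subset> Fm L \<longrightarrow>
             Zi \<inter> Fm_over L (Variables L - VarsOf Y) = Zk \<inter> Fm_over L (Variables L - VarsOf Y) \<and>
             Zj \<inter> Fm_over L (VarsOf Y) \<subseteq> Zk))"

definition couniform_atlas :: "('f, 'v) lang \<Rightarrow> ('f, 'a, 'i) atlas \<Rightarrow> bool" where
  "couniform_atlas L \<A> \<longleftrightarrow>
     (\<forall>XX. separated L XX \<longrightarrow>
       (\<forall>X\<in>XX. \<exists>j\<in>Index \<A>. \<exists>Zj\<in>SS L \<A> j. X \<subseteq> Zj \<and> Zj \<subset> Fm L) \<longrightarrow>
       (\<exists>k\<in>Index \<A>. \<exists>Zk\<in>SS L \<A> k. \<Union>XX \<subseteq> Zk \<and> Zk \<subset> Fm L))"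


section \<open>When the Wojcicki relation is an abstract logic\<close>

text \<open>For structural \<open>S\<close>, the relation \<open>wojcicki L L' S\<close> is reflexive, monotone and closed
  under substitutions, but it need not be closed under cut if \<open>L\<close> has more symbols than
  variables, even if \<open>S\<close> is uniform and couniform. Take countably many variables in \<open>L\<close> and,
  for \<open>i\<close> in an uncountable set, binary \<open>f\<^sub>i\<close>, unary \<open>g\<^sub>i\<close> and \<open>h\<close>, with the rules
  \<open>f\<^sub>i(a, b) / g\<^sub>i(a)\<close> and \<open>{g\<^sub>i(a) | i} / h(a)\<close>. In an extension with uncountably many
  variables, every \<open>g\<^sub>i(p)\<close> follows from \<open>{f\<^sub>i(p, q\<^sub>i) | i}\<close>, but \<open>h(p)\<close> does not.
  A relation determined by an atlas is closed under cut, so that a theorem about the Wojcicki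
  \<^emph>\<open>logic\<close> must take for granted that the relation is one. The lemma
  \<open>wojcicki_abstract_logic\<close> shows that it is whenever \<open>L\<close> has at most as many symbols as
  variables, in particular when \<open>L\<close> has countably many symbols.\<close>

lemma finite_ordLeq_infinite: "finite A \<Longrightarrow> infinite B \<Longrightarrow> |A| \<le>o |B|"
  by (meson card_of_Well_order card_of_ordLeq_finite ordLeq_total)

lemma Un_ordLeq_infinite:
  "infinite C \<Longrightarrow> |A| \<le>o |C| \<Longrightarrow> |B| \<le>o |C| \<Longrightarrow> |A \<union> B| \<le>o |C|"
  using card_of_Un_ordLeq_infinite_Field[of "|C|" A B] card_of_Card_order[of C]
  by (simp add: Field_card_of)

lemma Times_ordLeq_infinite:
  "infinite C \<Longrightarrow> |A| \<le>o |C| \<Longrightarrow> |B| \<le>o |C| \<Longrightarrow> |A \<times> B| \<le>o |C|"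
  using card_of_Times_ordLeq_infinite_Field[of "|C|" A B] card_of_Card_order[of C]
  by (simp add: Field_card_of)

lemma Fm_card:
  assumes inf: "infinite (Variables L)" and le: "|Symbols L| \<le>o |Variables L|"
  shows "|Fm L| \<le>o |Variables L|"
proof -
  let ?V = "Variables L"
  define T where "T = rec_nat (Var ` ?V)
    (\<lambda>_ F. F \<union> (\<Union>n. {App f ts | f ts. f \<in> Symbols L \<and> ts \<in> {ts. set ts \<subseteq> F \<and> length ts = n}}))"
  have T0: "T 0 = Var ` ?V" by (simp add: T_def)
  have TS: "T (Suc m) = T m \<union>
    (\<Union>n. {App f ts | f ts. f \<in> Symbols L \<and> ts \<in> {ts. set ts \<subseteq> T m \<and> length ts = n}})" for m
    by (simp add: T_def)
  have natV: "|UNIV :: nat set| \<le>o |?V|"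
    using inf infinite_iff_card_of_nat by blast
  have un: "|A \<union> B| \<le>o |?V|" if "|A| \<le>o |?V|" "|B| \<le>o |?V|" for A B :: "('f, 'v) fm set"
    using Un_ordLeq_infinite[OF inf that] .
  have lists_n: "|{ts. set ts \<subseteq> A \<and> length ts = n}| \<le>o |?V|"
    if A: "|A| \<le>o |?V|" for A :: "('f, 'v) fm set" and n
  proof (induction n)
    case 0
    have "{ts. set ts \<subseteq> A \<and> length ts = 0} = {[]}" by auto
    moreover have "|{[] :: ('f, 'v) fm list}| \<le>o |?V|"
      using inf by (intro finite_ordLeq_infinite) simp_all
    ultimately show ?case by simp
  next
    case (Suc n)
    have "{ts. set ts \<subseteq> A \<and> length ts = Suc n} =
        (\<lambda>(t, ts). t # ts) ` (A \<times> {ts. set ts \<subseteq> A \<and> length ts = n})"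
      by (auto simp: length_Suc_conv image_iff)
    moreover have "|A \<times> {ts. set ts \<subseteq> A \<and> length ts = n}| \<le>o |?V|"
      using Times_ordLeq_infinite[OF inf A Suc.IH] .
    ultimately show ?case
      using ordLeq_transitive[OF card_of_image] by simp
  qed
  have Tle: "|T m| \<le>o |?V|" for m
  proof (induction m)
    case 0
    then show ?case by (simp add: T0 card_of_image)
  next
    case (Suc m)
    have "|{App f ts | f ts. f \<in> Symbols L \<and> ts \<in> {ts. set ts \<subseteq> T m \<and> length ts = n}}| \<le>o |?V|" for n
    proof -
      have "{App f ts | f ts. f \<in> Symbols L \<and> ts \<in> {ts. set ts \<subseteq> T m \<and> length ts = n}} =
          (\<lambda>(f, ts). App f ts) ` (Symbols L \<times> {ts. set ts \<subseteq> T m \<and> length ts = n})"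
        by (auto simp: image_iff)
      moreover have "|Symbols L \<times> {ts. set ts \<subseteq> T m \<and> length ts = n}| \<le>o |?V|"
        using Times_ordLeq_infinite[OF inf le lists_n[OF Suc.IH]] .
      ultimately show ?thesis
        using ordLeq_transitive[OF card_of_image] by simp
    qed
    then show ?case
      unfolding TS using inf natV
      by (intro un Suc.IH card_of_UNION_ordLeq_infinite) auto
  qed
  have mono: "T m \<subseteq> T m'" if "m \<le> m'" for m m'
    using that by (induction rule: dec_induct) (auto simp: TS)
  have "\<alpha> \<in> (\<Union>m. T m)" if "\<alpha> \<in> Fm L" for \<alpha>
    using that
  proof (induction)
    case (Fm_Var p)
    then show ?case using T0 by blast
  next
    case (Fm_App f ts)
    have "\<forall>t\<in>set ts. \<exists>m. t \<in> T m" using Fm_App.IH by blast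
    then obtain k where k: "\<forall>t\<in>set ts. t \<in> T (k t)" by metis
    have "set ts \<subseteq> T (Max (k ` set ts))"
    proof
      fix t assume t: "t \<in> set ts"
      then have "k t \<le> Max (k ` set ts)" by (intro Max_ge) auto
      then show "t \<in> T (Max (k ` set ts))" using mono k t by blast
    qed
    then have "App f ts \<in> T (Suc (Max (k ` set ts)))"
      using Fm_App.hyps by (auto simp: TS)
    then show ?case by blast
  qed
  then have "Fm L \<subseteq> (\<Union>m. T m)" by (rule subsetI)
  moreover have "|\<Union>m. T m| \<le>o |?V|"
    using inf natV Tle by (intro card_of_UNION_ordLeq_infinite) auto
  ultimately show ?thesis
    using card_of_mono1 ordLeq_transitive by blast
qed

lemma subst_subst: "subst s (subst t \<alpha>) = subst (\<lambda>p. subst s (t p)) \<alpha>"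
  by (induction \<alpha>) auto

lemma subst_cong: "(\<And>p. p \<in> vars_of \<alpha> \<Longrightarrow> s p = t p) \<Longrightarrow> subst s \<alpha> = subst t \<alpha>"
  by (induction \<alpha>) auto

lemma subst_Var: "subst Var \<alpha> = \<alpha>"
  by (induction \<alpha>) (auto simp: map_idI)

lemma Fm_subst:
  assumes "\<alpha> \<in> Fm L" "Symbols L = Symbols L'" "\<forall>f\<in>Symbols L. arity L f = arity L' f"
    and "\<And>p. p \<in> vars_of \<alpha> \<Longrightarrow> s p \<in> Fm L'"
  shows "subst s \<alpha> \<in> Fm L'"
  using assms
proof (induction)
  case (Fm_App f ts)
  have "subst s x \<in> Fm L'" if x: "x \<in> set ts" for x
    using Fm_App.IH[OF x] Fm_App.prems x by (metis UN_I fm.set(4))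
  then show ?case using Fm_App by (auto intro!: Fm.intros)
qed (auto intro: Fm.intros)

lemma vars_Fm: "\<alpha> \<in> Fm L \<Longrightarrow> vars_of \<alpha> \<subseteq> Variables L"
  by (induction rule: Fm.induct) auto

lemma finite_vars_of: "finite (vars_of \<alpha>)"
  by (induction \<alpha>) auto

lemma VarsOf_card:
  assumes "infinite B" "|X| \<le>o |B|"
  shows "|VarsOf X| \<le>o |B|"
  unfolding VarsOf_def using assms finite_vars_of
  by (intro card_of_UNION_ordLeq_infinite)
     (auto intro: finite_ordLeq_infinite)

lemma wojcicki_abstract_logic:
  fixes L L' :: "('f, 'v) lang"
  assumes inf: "infinite (Variables L)" and le: "|Symbols L| \<le>o |Variables L|"
    and ext: "primitive_extension L L'"
    and log: "abstract_logic L S" and str: "structural L S"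
  shows "abstract_logic L' (wojcicki L L' S)"
proof -
  let ?V = "Variables L"
  have sym: "Symbols L = Symbols L'" "\<forall>f\<in>Symbols L. arity L f = arity L' f"
    and VV: "?V \<subseteq> Variables L'"
    using ext by (auto simp: primitive_extension_def)
  have sym': "Symbols L' = Symbols L" "\<forall>f\<in>Symbols L'. arity L' f = arity L f"
    using sym by auto
  note log' = log[unfolded abstract_logic_def]
  note refl = log'[THEN conjunct1, rule_format]
    and mono = log'[THEN conjunct2, THEN conjunct1, rule_format]
    and cut = log'[THEN conjunct2, THEN conjunct2, rule_format]
  obtain p0 where p0: "p0 \<in> ?V"
    using infinite_imp_nonempty[OF inf] by blast
  have W1: "wojcicki L L' S X \<alpha>" if X: "X \<subseteq> Fm L'" and \<alpha>: "\<alpha> \<in> X" for X \<alpha>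
  proof -
    have "Var p0 \<in> Fm L" using p0 by (rule Fm_Var)
    moreover have "substitution L' (\<lambda>_. \<alpha>)" using X \<alpha> by (auto simp: substitution_def)
    ultimately show ?thesis
      unfolding wojcicki_def using X \<alpha> refl[of "{Var p0}" "Var p0"]
      by (intro conjI exI[of _ "{Var p0}"] exI[of _ "Var p0"] exI[of _ "\<lambda>_. \<alpha>"]) auto
  qed
  have W2: "wojcicki L L' S Y \<alpha>"
    if Y: "Y \<subseteq> Fm L'" "X \<subseteq> Y" and woj: "wojcicki L L' S X \<alpha>" for X Y \<alpha>
  proof -
    obtain Z \<gamma> s where "Z \<subseteq> Fm L" "\<gamma> \<in> Fm L" "substitution L' s" "subst s ` Z \<subseteq> X"
        "\<alpha> = subst s \<gamma>" "S Z \<gamma>" and \<alpha>: "\<alpha> \<in> Fm L'"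
      using woj unfolding wojcicki_def by blast
    then show ?thesis
      unfolding wojcicki_def using Y
      by (intro conjI exI[of _ Z] exI[of _ \<gamma>] exI[of _ s]) auto
  qed
  have W3: "wojcicki L L' S X \<alpha>"
    if X: "X \<subseteq> Fm L'" and Y: "Y \<subseteq> Fm L'" and \<alpha>: "\<alpha> \<in> Fm L'"
      and XY: "\<forall>\<beta>\<in>Y. wojcicki L L' S X \<beta>" and XYa: "wojcicki L L' S (X \<union> Y) \<alpha>" for X Y \<alpha>
  proof -
    obtain Z \<gamma> s where Z: "Z \<subseteq> Fm L" "\<gamma> \<in> Fm L" "substitution L' s"
        "subst s ` Z \<subseteq> X \<union> Y" "\<alpha> = subst s \<gamma>" "S Z \<gamma>"
      using XYa unfolding wojcicki_def by blast
    have "\<forall>\<beta>\<in>Y. \<exists>Z' \<gamma>' s'. Z' \<subseteq> Fm L \<and> \<gamma>' \<in> Fm L \<and> substitution L' s' \<and>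
        subst s' ` Z' \<subseteq> X \<and> \<beta> = subst s' \<gamma>' \<and> S Z' \<gamma>'"
      using XY unfolding wojcicki_def by blast
    then obtain ZZ gg ss where W: "\<And>\<beta>. \<beta> \<in> Y \<Longrightarrow> ZZ \<beta> \<subseteq> Fm L \<and> gg \<beta> \<in> Fm L \<and>
        substitution L' (ss \<beta>) \<and> subst (ss \<beta>) ` ZZ \<beta> \<subseteq> X \<and> \<beta> = subst (ss \<beta>) (gg \<beta>) \<and>
        S (ZZ \<beta>) (gg \<beta>)"
      by metis
    define Y0 where "Y0 = Y \<inter> subst s ` Z"
    define X0 where "X0 = (X \<inter> subst s ` Z) \<union> (\<Union>\<beta>\<in>Y0. subst (ss \<beta>) ` ZZ \<beta>)"
    define U where "U = VarsOf (X0 \<union> Y0 \<union> {\<alpha>})"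
    have FmV: "|Fm L| \<le>o |?V|" using Fm_card[OF inf le] .
    have small: "|subst t ` Q| \<le>o |?V|" if "Q \<subseteq> Fm L" for t :: "'v \<Rightarrow> ('f, 'v) fm" and Q
      using card_of_image[of "subst t" Q] card_of_mono1[OF that] FmV ordLeq_transitive by blast
    have Y0V: "|Y0| \<le>o |?V|"
      using small[OF Z(1), of s] card_of_mono1[of Y0 "subst s ` Z"] ordLeq_transitive
      unfolding Y0_def by blast
    have un: "|A \<union> B| \<le>o |?V|" if "|A| \<le>o |?V|" "|B| \<le>o |?V|" for A B :: "('f, 'v) fm set"
      using Un_ordLeq_infinite[OF inf that] .
    have "|X \<inter> subst s ` Z| \<le>o |?V|"
      using small[OF Z(1), of s] card_of_mono1[of "X \<inter> subst s ` Z" "subst s ` Z"]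
        ordLeq_transitive by blast
    moreover have "|\<Union>\<beta>\<in>Y0. subst (ss \<beta>) ` ZZ \<beta>| \<le>o |?V|"
      using inf Y0V W small by (intro card_of_UNION_ordLeq_infinite) (auto simp: Y0_def)
    ultimately have "|X0 \<union> Y0 \<union> {\<alpha>}| \<le>o |?V|"
      unfolding X0_def using Y0V inf by (intro un) (auto intro: finite_ordLeq_infinite)
    then have "|U| \<le>o |?V|" unfolding U_def using inf by (rule_tac VarsOf_card)
    then obtain g where g: "inj_on g U" "g ` U \<subseteq> ?V"
      using card_of_ordLeq by metis
    define t where "t = (\<lambda>p. Var (if p \<in> U then g p else p0) :: ('f, 'v) fm)"
    define t' where "t' = (\<lambda>q. Var (if q \<in> g ` U then inv_into U g q else p0) :: ('f, 'v) fm)"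
    have UL': "U \<subseteq> Variables L'"
    proof -
      have "X0 \<union> Y0 \<union> {\<alpha>} \<subseteq> Fm L'" using X Y \<alpha> W unfolding X0_def Y0_def by blast
      then show ?thesis unfolding U_def VarsOf_def using vars_Fm by blast
    qed
    have tL: "t p \<in> Fm L" for p
      unfolding t_def using g p0 by (auto intro!: Fm_Var)
    have t'L': "substitution L' t'"
      unfolding substitution_def t'_def using UL' VV p0
      by (auto intro!: Fm_Var simp: inv_into_into subset_iff)
    have inverse: "subst t' (subst t \<delta>) = \<delta>" if \<delta>: "\<delta> \<in> X0 \<union> Y0 \<union> {\<alpha>}" for \<delta>
    proof -
      have "subst t' (t p) = Var p" if "p \<in> vars_of \<delta>" for p
      proof -
        have "p \<in> U" using that \<delta> unfolding U_def VarsOf_def by blast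
        then show ?thesis using g(1) by (simp add: t_def t'_def)
      qed
      then have "subst t' (subst t \<delta>) = subst Var \<delta>"
        unfolding subst_subst by (intro subst_cong) auto
      then show ?thesis by (simp add: subst_Var)
    qed
    have tFm: "subst t \<delta> \<in> Fm L" if "\<delta> \<in> Fm L'" for \<delta>
      using Fm_subst[OF that sym'] tL by blast
    have X0: "X0 \<subseteq> X" unfolding X0_def Y0_def using W by blast
    have comp: "S (subst t ` subst r ` Q) (subst t (subst r \<delta>))"
      if "substitution L' r" "Q \<subseteq> Fm L" "\<delta> \<in> Fm L" "S Q \<delta>" for r Q \<delta>
    proof -
      have "substitution L (\<lambda>p. subst t (r p))"
        using that(1) VV tFm unfolding substitution_def by blast
      then have "S (subst (\<lambda>p. subst t (r p)) ` Q) (subst (\<lambda>p. subst t (r p)) \<delta>)"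
        using str[unfolded structural_def, rule_format, OF _ that(2-4)] by blast
      then show ?thesis by (simp add: image_image subst_subst)
    qed
    have tX0: "subst t ` X0 \<subseteq> Fm L" using X0 X tFm by blast
    have tY0: "subst t ` Y0 \<subseteq> Fm L" using Y tFm unfolding Y0_def by blast
    have t\<alpha>: "subst t \<alpha> \<in> Fm L" using \<alpha> tFm by blast
    have "S (subst t ` X0) (subst t \<beta>)" if b: "\<beta> \<in> Y0" for \<beta>
    proof -
      have bY: "\<beta> \<in> Y" using b by (simp add: Y0_def)
      have "S (subst t ` subst (ss \<beta>) ` ZZ \<beta>) (subst t \<beta>)"
        using comp[of "ss \<beta>" "ZZ \<beta>" "gg \<beta>"] W[OF bY] by simp
      moreover have "subst (ss \<beta>) ` ZZ \<beta> \<subseteq> X0" unfolding X0_def using b by blast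
      ultimately show ?thesis
        using tY0 b by (intro mono[OF tX0 _ image_mono]) auto
    qed
    moreover have "S (subst t ` X0 \<union> subst t ` Y0) (subst t \<alpha>)"
    proof -
      have "S (subst t ` subst s ` Z) (subst t \<alpha>)" using comp[of s Z \<gamma>] Z by simp
      moreover have "subst s ` Z \<subseteq> X0 \<union> Y0" unfolding X0_def Y0_def using Z(4) by blast
      then have "subst t ` subst s ` Z \<subseteq> subst t ` X0 \<union> subst t ` Y0" by blast
      ultimately show ?thesis using mono[OF Un_least[OF tX0 tY0] t\<alpha>] by blast
    qed
    ultimately have "S (subst t ` X0) (subst t \<alpha>)"
      by (intro cut[OF tX0 tY0 t\<alpha>]) blast+
    moreover have "subst t' ` subst t ` X0 = X0"
      using inverse by (simp add: image_image)
    moreover have "subst t' (subst t \<alpha>) = \<alpha>" using inverse by blast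
    ultimately show ?thesis
      unfolding wojcicki_def using X \<alpha> X0 tX0 t\<alpha> t'L'
      by (intro conjI exI[of _ "subst t ` X0"] exI[of _ "subst t \<alpha>"] exI[of _ t']) auto
  qed
  show ?thesis
    unfolding abstract_logic_def
    by (intro conjI allI impI) (erule (1) W1, erule (2) W2, erule (4) W3)
qed

end

(* The atlas is the Lindenbaum atlas of the Wojcicki logic: the formula algebra of L' together
   with all theories. Inverse images of theories under L-valuations are exactly the theories of S,
   because the Wojcicki logic is conservative over S. Since uniformity and couniformity of an atlas
   depend only on these inverse images, everything reduces to carrying uniformity and couniformity
   of S over to the Wojcicki logic. One derivation in the latter involves only formulas subst s z
   with z in Fm L, hence at most card (Variables L) variables, however many symbols there are. They
   can be renamed injectively into Variables L with one variable left out, and an inconsistent set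
   is recognised by its proving a fresh variable. *)

theory Submission
  imports Defs
begin

section \<open>Variables under substitution, and the rules of an abstract logic in usable
  form\<close>

lemma vars_of_subst: "vars_of (subst s \<alpha>) = (\<Union>p\<in>vars_of \<alpha>. vars_of (s p))"
  by (induction \<alpha>) auto

lemma VarsOf_mono: "X \<subseteq> Y \<Longrightarrow> VarsOf X \<subseteq> VarsOf Y"
  unfolding VarsOf_def by blast

lemma VarsOf_subset: "X \<subseteq> Fm L \<Longrightarrow> VarsOf X \<subseteq> Variables L"
  unfolding VarsOf_def using vars_Fm by blast

lemma VarsOf_rename: "VarsOf (subst (\<lambda>q. Var (g q)) ` X) = g ` VarsOf X"
  unfolding VarsOf_def by (auto simp: vars_of_subst)

lemma primitive_extension_refl: "language L \<Longrightarrow> primitive_extension L L"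
  by (simp add: primitive_extension_def)

lemma primitive_extension_Fm:
  assumes "primitive_extension L L'"
  shows "Fm L \<subseteq> Fm L'"
proof
  fix \<alpha> assume \<alpha>: "\<alpha> \<in> Fm L"
  have "subst Var \<alpha> \<in> Fm L'"
    using assms vars_Fm[OF \<alpha>]
    by (intro Fm_subst[OF \<alpha>]) (auto simp: primitive_extension_def intro!: Fm_Var)
  then show "\<alpha> \<in> Fm L'" by (simp add: subst_Var)
qed

lemma substitution_Fm: "substitution L s \<Longrightarrow> \<alpha> \<in> Fm L \<Longrightarrow> subst s \<alpha> \<in> Fm L"
  using Fm_subst[of \<alpha> L L s] vars_Fm[of \<alpha> L] by (auto simp: substitution_def)

lemma abstract_logic_refl:
  assumes "abstract_logic L S"
  shows "X \<subseteq> Fm L \<Longrightarrow> \<alpha> \<in> X \<Longrightarrow> S X \<alpha>"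
  using assms[unfolded abstract_logic_def, THEN conjunct1, rule_format] .

lemma abstract_logic_mono:
  assumes "abstract_logic L S"
  shows "Y \<subseteq> Fm L \<Longrightarrow> \<alpha> \<in> Fm L \<Longrightarrow> X \<subseteq> Y \<Longrightarrow> S X \<alpha> \<Longrightarrow> S Y \<alpha>"
  using assms[unfolded abstract_logic_def, THEN conjunct2, THEN conjunct1, rule_format] .

lemma abstract_logic_cut:
  assumes "abstract_logic L S"
  shows "X \<subseteq> Fm L \<Longrightarrow> Y \<subseteq> Fm L \<Longrightarrow> \<alpha> \<in> Fm L \<Longrightarrow> (\<And>\<beta>. \<beta> \<in> Y \<Longrightarrow> S X \<beta>) \<Longrightarrow>
    S (X \<union> Y) \<alpha> \<Longrightarrow> S X \<alpha>"
  using assms[unfolded abstract_logic_def, THEN conjunct2, THEN conjunct2, rule_format] .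

lemma structuralD:
  assumes "structural L S"
  shows "substitution L s \<Longrightarrow> X \<subseteq> Fm L \<Longrightarrow> \<alpha> \<in> Fm L \<Longrightarrow> S X \<alpha> \<Longrightarrow>
    S (subst s ` X) (subst s \<alpha>)"
  using assms[unfolded structural_def, rule_format] .

lemma consistent_subset:
  assumes "abstract_logic L S" "Y \<subseteq> Fm L" "consistent L S Y" "X \<subseteq> Y"
  shows "consistent L S X"
  using assms(3) abstract_logic_mono[OF assms(1,2) _ assms(4)] by (auto simp: consistent_def Cn_def)

lemma inconsistent_iff: "\<not> consistent L S X \<longleftrightarrow> (\<forall>\<alpha>\<in>Fm L. S X \<alpha>)"
  unfolding consistent_def Cn_def by blast


section \<open>Theories and atlases\<close>

text \<open>The inconsistent theory \<open>Fm L\<close> is included, so a family indexed by theories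
  is never empty.\<close>

definition theories :: "('f, 'v) lang \<Rightarrow> ('f, 'v) conseq \<Rightarrow> ('f, 'v) fm set set" where
  "theories L S = {T. T \<subseteq> Fm L \<and> Cn L S T \<subseteq> T}"

lemma Cn_superset: "abstract_logic L S \<Longrightarrow> X \<subseteq> Fm L \<Longrightarrow> X \<subseteq> Cn L S X"
  using abstract_logic_refl[of L S X] by (auto simp: Cn_def)

lemma Cn_in_theories:
  assumes "abstract_logic L S" "X \<subseteq> Fm L"
  shows "Cn L S X \<in> theories L S"
proof -
  have "S X \<alpha>" if "\<alpha> \<in> Fm L" "S (Cn L S X) \<alpha>" for \<alpha>
  \<comment> \<open>Cut is taken with the whole closure as the set of intermediate conclusions; by
    reflexivity it absorbs \<open>X\<close>.\<close>
  proof (rule abstract_logic_cut[OF assms _ that(1), of "Cn L S X"])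
    show "S (X \<union> Cn L S X) \<alpha>" using Cn_superset[OF assms] that(2) by (simp add: Un_absorb1)
  qed (auto simp: Cn_def)
  then have "Cn L S (Cn L S X) \<subseteq> Cn L S X" by (auto simp: Cn_def)
  then show ?thesis by (simp add: theories_def) (simp add: Cn_def)
qed

lemma theories_Cn_subset:
  assumes "abstract_logic L S" "T \<in> theories L S" "X \<subseteq> T"
  shows "Cn L S X \<subseteq> T"
proof
  fix \<alpha> assume \<alpha>: "\<alpha> \<in> Cn L S X"
  have T: "T \<subseteq> Fm L" "Cn L S T \<subseteq> T" using assms(2) by (simp_all add: theories_def)
  have "S T \<alpha>" using abstract_logic_mono[OF assms(1) T(1) _ assms(3)] \<alpha> by (simp add: Cn_def)
  then show "\<alpha> \<in> T" using T(2) \<alpha> by (auto simp: Cn_def)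
qed

lemma consistent_iff_theory:
  assumes "abstract_logic L S" "X \<subseteq> Fm L"
  shows "consistent L S X \<longleftrightarrow> (\<exists>T\<in>theories L S. X \<subseteq> T \<and> T \<subset> Fm L)"
proof
  assume "consistent L S X"
  then have "X \<subseteq> Cn L S X \<and> Cn L S X \<subset> Fm L"
    using Cn_superset[OF assms] unfolding consistent_def Cn_def by blast
  then show "\<exists>T\<in>theories L S. X \<subseteq> T \<and> T \<subset> Fm L"
    using Cn_in_theories[OF assms] by blast
next
  assume "\<exists>T\<in>theories L S. X \<subseteq> T \<and> T \<subset> Fm L"
  then show "consistent L S X"
    using theories_Cn_subset[OF assms(1)] unfolding consistent_def by blast
qed

text \<open>The closure of \<open>X\<close> is the least theory containing \<open>X\<close>, so
  following from \<open>X\<close> means lying in every theory above it. Quantifying over valuations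
  and filters amounts to quantifying over their inverse images.\<close>

lemma determined_by_theories:
  assumes log: "abstract_logic L S" and th: "(\<Union>i\<in>Index \<A>. SS L \<A> i) = theories L S"
  shows "determined_by L S \<A>"
  unfolding determined_by_def
proof (intro allI impI)
  fix X \<alpha> assume X: "X \<subseteq> Fm L" and \<alpha>: "\<alpha> \<in> Fm L"
  define Z where "Z v i = {\<beta> \<in> Fm L. v \<beta> \<in> Filter \<A> i}" for v i
  have "v ` X \<subseteq> Filter \<A> i \<longleftrightarrow> X \<subseteq> Z v i" "v \<alpha> \<in> Filter \<A> i \<longleftrightarrow> \<alpha> \<in> Z v i" for v i
    using X \<alpha> by (auto simp: Z_def)
  then have "atlas_conseq L \<A> X \<alpha> \<longleftrightarrow>
      (\<forall>i\<in>Index \<A>. \<forall>v. valuation L (Alg \<A>) v \<longrightarrow> X \<subseteq> Z v i \<longrightarrow> \<alpha> \<in> Z v i)"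
    by (simp add: atlas_conseq_def)
  also have "\<dots> \<longleftrightarrow> (\<forall>Y \<in> (\<Union>i\<in>Index \<A>. SS L \<A> i). X \<subseteq> Y \<longrightarrow> \<alpha> \<in> Y)"
    unfolding SS_def Z_def[symmetric] by blast
  also have "\<dots> \<longleftrightarrow> (\<forall>Z\<in>theories L S. X \<subseteq> Z \<longrightarrow> \<alpha> \<in> Z)" unfolding th ..
  also have "\<dots> \<longleftrightarrow> \<alpha> \<in> Cn L S X"
    using Cn_in_theories[OF log X] Cn_superset[OF log X] theories_Cn_subset[OF log] by blast
  finally show "S X \<alpha> \<longleftrightarrow> atlas_conseq L \<A> X \<alpha>" using \<alpha> by (simp add: Cn_def)
qed

text \<open>The theory generated by the part of \<open>Zi\<close> avoiding \<open>V\<close> and the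
  part of \<open>Zj\<close> over \<open>V\<close> serves as \<open>Zk\<close>. The second part is
  consistent, so by uniformity of \<open>S\<close> it adds no consequence whose variables avoid
  \<open>V\<close>.\<close>

lemma uniform_atlas_theories:
  assumes log: "abstract_logic L S" and th: "(\<Union>i\<in>Index \<A>. SS L \<A> i) = theories L S"
    and unif: "uniform_logic L S"
  shows "uniform_atlas L \<A>"
proof -
  have "\<exists>k\<in>Index \<A>. \<exists>Zk\<in>SS L \<A> k.
      Zi \<inter> Fm_over L (Variables L - V) = Zk \<inter> Fm_over L (Variables L - V) \<and>
      Zj \<inter> Fm_over L V \<subseteq> Zk"
    if ij: "i \<in> Index \<A>" "j \<in> Index \<A>" "Zi \<in> SS L \<A> i" "Zj \<in> SS L \<A> j" "Zj \<subset> Fm L"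
    for V i j Zi Zj
  proof -
    define P where "P = Zi \<inter> Fm_over L (Variables L - V)"
    define Q where "Q = Zj \<inter> Fm_over L V"
    have Zi: "Zi \<in> theories L S" and Zj: "Zj \<in> theories L S" using th ij by blast+
    have PQ: "P \<subseteq> Fm L" "Q \<subseteq> Fm L" by (auto simp: P_def Q_def Fm_over_def)
    have "consistent L S Q"
      using consistent_iff_theory[OF log PQ(2)] Zj ij(5) by (auto simp: Q_def)
    moreover have "VarsOf (P \<union> {\<alpha>}) \<inter> VarsOf Q = {}" if "\<alpha> \<in> Fm_over L (Variables L - V)" for \<alpha>
      using that by (auto simp: P_def Q_def Fm_over_def VarsOf_def)
    ultimately have "S P \<alpha>" if "\<alpha> \<in> Fm_over L (Variables L - V)" "\<alpha> \<in> Cn L S (P \<union> Q)" for \<alpha>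
      using unif[unfolded uniform_logic_def, rule_format, OF PQ, of \<alpha>] that by (simp add: Cn_def)
    then have "Cn L S (P \<union> Q) \<inter> Fm_over L (Variables L - V) \<subseteq> Zi"
      using theories_Cn_subset[OF log Zi, of P] by (auto simp: Cn_def P_def)
    moreover have "P \<union> Q \<subseteq> Cn L S (P \<union> Q)" using PQ by (intro Cn_superset[OF log]) auto
    moreover have "Cn L S (P \<union> Q) \<in> (\<Union>i\<in>Index \<A>. SS L \<A> i)"
      unfolding th using PQ by (intro Cn_in_theories[OF log]) auto
    ultimately show ?thesis unfolding P_def Q_def by blast
  qed
  \<comment> \<open>\<open>V\<close> becomes \<open>VarsOf Y\<close>; when \<open>Zj\<close> is not
    proper, \<open>i\<close> and \<open>Zi\<close> are vacuous witnesses.\<close>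
  then show ?thesis unfolding uniform_atlas_def by meson
qed

text \<open>Lying in a proper theory is the same as being consistent, so this is couniformity of
  \<open>S\<close> in contrapositive form.\<close>

lemma couniform_atlas_theories:
  assumes log: "abstract_logic L S" and th: "(\<Union>i\<in>Index \<A>. SS L \<A> i) = theories L S"
    and counif: "couniform_logic L S"
  shows "couniform_atlas L \<A>"
proof -
  have con: "(\<exists>j\<in>Index \<A>. \<exists>Zj\<in>SS L \<A> j. X \<subseteq> Zj \<and> Zj \<subset> Fm L) \<longleftrightarrow> consistent L S X"
    if "X \<subseteq> Fm L" for X
    unfolding consistent_iff_theory[OF log that] th[symmetric] by blast
  show ?thesis
    unfolding couniform_atlas_def
  proof (intro allI impI)
    fix XX
    assume sep: "separated L XX"
      and *: "\<forall>X\<in>XX. \<exists>j\<in>Index \<A>. \<exists>Zj\<in>SS L \<A> j. X \<subseteq> Zj \<and> Zj \<subset> Fm L"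
    have sub: "X \<subseteq> Fm L" if "X \<in> XX" for X using sep that by (simp add: separated_def)
    have "consistent L S X" if "X \<in> XX" for X using con[OF sub[OF that]] * that by simp
    then have "consistent L S (\<Union>XX)"
      using counif[unfolded couniform_logic_def, rule_format, OF sep] by meson
    then show "\<exists>k\<in>Index \<A>. \<exists>Zk\<in>SS L \<A> k. \<Union>XX \<subseteq> Zk \<and> Zk \<subset> Fm L"
      using con[OF Union_least[OF sub]] by simp
  qed
qed

section \<open>The Lindenbaum atlas, read also in a smaller language\<close>

definition lindenbaum ::
  "('f, 'v) lang \<Rightarrow> ('f, 'v) conseq \<Rightarrow> ('f, ('f, 'v) fm, ('f, 'v) fm set) atlas" where
  "lindenbaum L S = \<lparr>Alg = \<lparr>carrier = Fm L, oper = App\<rparr>, Index = theories L S, Filter = id\<rparr>"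

text \<open>A homomorphism on formulas is fixed by its values on variables; valuations in a formula
  algebra thus become substitutions, to which structurality applies.\<close>

lemma valuation_eq_subst:
  assumes "valuation L \<lparr>carrier = C, oper = App\<rparr> v" "\<alpha> \<in> Fm L"
  shows "v \<alpha> = subst (\<lambda>p. v (Var p)) \<alpha>"
  using assms(2)
proof (induction)
  case (Fm_App f ts)
  then have "set ts \<subseteq> Fm L" by (intro subsetI)
  then have "v (App f ts) = App f (map v ts)"
    using assms(1) Fm_App.hyps(1,2) by (simp add: valuation_def)
  moreover have "map v ts = map (subst (\<lambda>p. v (Var p))) ts"
    using Fm_App.IH by (intro map_cong refl)
  ultimately show ?case by (simp only: subst.simps)
qed simp

lemma is_atlas_lindenbaum:
  assumes ext: "primitive_extension L L'" and "Variables L' \<noteq> {}"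
  shows "is_atlas L (lindenbaum L' S)"
proof -
  have "Fm L' \<noteq> {}" using assms(2) Fm_Var[of _ L'] by (metis equals0I equals0D)
  moreover have "Fm L' \<in> theories L' S" by (auto simp: theories_def Cn_def)
  moreover have "App f ts \<in> Fm L'"
    if "f \<in> Symbols L" "length ts = arity L f" "set ts \<subseteq> Fm L'" for f ts
    using that ext by (intro Fm_App) (auto simp: primitive_extension_def)
  ultimately show ?thesis
    by (auto simp: is_atlas_def algebra_def lindenbaum_def theories_def)
qed

text \<open>By structurality, the inverse image of a theory under a substitution is a theory.
  Conversely, a theory \<open>T\<close> of \<open>S\<close> is the trace on \<open>Fm L\<close> of
  the theory it generates in \<open>L'\<close>, since \<open>W\<close> is conservative over
  \<open>S\<close>.\<close>

lemma SS_lindenbaum: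
  assumes ext: "primitive_extension L L'"
    and log: "abstract_logic L' W" and str: "structural L' W"
    and cons: "\<And>X \<alpha>. X \<subseteq> Fm L \<Longrightarrow> \<alpha> \<in> Fm L \<Longrightarrow> W X \<alpha> \<longleftrightarrow> S X \<alpha>"
  shows "(\<Union>i\<in>Index (lindenbaum L' W). SS L (lindenbaum L' W) i) = theories L S"
proof -
  let ?A = "\<lparr>carrier = Fm L', oper = App\<rparr>"
  have FmL: "Fm L \<subseteq> Fm L'" using primitive_extension_Fm[OF ext] .
  have "{\<alpha> \<in> Fm L. v \<alpha> \<in> T} \<in> theories L S"
    if T: "T \<in> theories L' W" and v: "valuation L ?A v" for T v
  proof -
    define Z where "Z = {\<alpha> \<in> Fm L. v \<alpha> \<in> T}"
    \<comment> \<open>A valuation for \<open>L\<close> is unconstrained outside \<open>Fm L\<close>,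
      so the other variables are sent to themselves to obtain a substitution of
      \<open>L'\<close>.\<close>
    define s where "s = (\<lambda>p. if p \<in> Variables L then v (Var p) else Var p)"
    have s: "substitution L' s"
      using v unfolding substitution_def valuation_def s_def by (auto intro: Fm_Var)
    have vs: "v \<alpha> = subst s \<alpha>" if "\<alpha> \<in> Fm L" for \<alpha>
      unfolding valuation_eq_subst[OF v that] s_def
      using vars_Fm[OF that] by (intro subst_cong) auto
    have "v \<alpha> \<in> T" if \<alpha>: "\<alpha> \<in> Fm L" "S Z \<alpha>" for \<alpha>
    proof -
      have "W Z \<alpha>" using \<alpha> cons by (simp add: Z_def)
      then have "W (subst s ` Z) (subst s \<alpha>)"
        using \<alpha>(1) FmL by (intro structuralD[OF str s]) (auto simp: Z_def)
      moreover have "subst s ` Z \<subseteq> T" using vs by (auto simp: Z_def)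
      moreover have "subst s \<alpha> \<in> Fm L'" using substitution_Fm[OF s] \<alpha>(1) FmL by blast
      ultimately show ?thesis
        using theories_Cn_subset[OF log T, of "subst s ` Z"] vs[OF \<alpha>(1)] by (auto simp: Cn_def)
    qed
    then show ?thesis unfolding Z_def[symmetric] theories_def Cn_def by (auto simp: Z_def)
  qed
  moreover have "\<exists>T'\<in>theories L' W. \<exists>v. T = {\<alpha> \<in> Fm L. v \<alpha> \<in> T'} \<and> valuation L ?A v"
    if T: "T \<in> theories L S" for T
  proof -
    have TL: "T \<subseteq> Fm L" using T by (simp add: theories_def)
    then have TL': "T \<subseteq> Fm L'" using FmL by blast
    have "T = {\<alpha> \<in> Fm L. id \<alpha> \<in> Cn L' W T}"
    proof
      show "T \<subseteq> {\<alpha> \<in> Fm L. id \<alpha> \<in> Cn L' W T}"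
        using TL Cn_superset[OF log TL'] by auto
      show "{\<alpha> \<in> Fm L. id \<alpha> \<in> Cn L' W T} \<subseteq> T"
        using T cons[OF TL] by (auto simp: theories_def Cn_def)
    qed
    moreover have "valuation L ?A id" using FmL by (auto simp: valuation_def)
    ultimately show ?thesis using Cn_in_theories[OF log TL'] by blast
  qed
  ultimately show ?thesis by (auto simp: SS_def lindenbaum_def)
qed


section \<open>The Wojcicki logic\<close>

lemma wojcickiE:
  assumes "wojcicki L L' S X \<alpha>"
  obtains Y \<beta> s where "Y \<subseteq> Fm L" "\<beta> \<in> Fm L" "substitution L' s" "subst s ` Y \<subseteq> X"
    "\<alpha> = subst s \<beta>" "S Y \<beta>"
  using assms unfolding wojcicki_def by (elim conjE exE)

text \<open>The witnessing substitution is composed with \<open>s\<close>; \<open>Z\<close> and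
  \<open>\<beta>\<close> remain the same.\<close>

lemma structural_wojcicki:
  fixes L L' :: "('f, 'v) lang"
  shows "structural L' (wojcicki L L' S)"
  unfolding structural_def
proof (intro allI impI)
  fix s :: "'v \<Rightarrow> ('f, 'v) fm" and X \<alpha>
  assume s: "substitution L' s" and X: "X \<subseteq> Fm L'" and \<alpha>: "\<alpha> \<in> Fm L'"
    and "wojcicki L L' S X \<alpha>"
  then obtain Z \<beta> r where Z: "Z \<subseteq> Fm L" "\<beta> \<in> Fm L" "substitution L' r"
      "subst r ` Z \<subseteq> X" "\<alpha> = subst r \<beta>" "S Z \<beta>"
    by (elim wojcickiE)
  have "substitution L' (\<lambda>p. subst s (r p))"
    using Z(3) substitution_Fm[OF s] by (simp add: substitution_def)
  moreover have "subst (\<lambda>p. subst s (r p)) ` Z \<subseteq> subst s ` X"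
    using Z(4) by (auto simp: subst_subst[symmetric])
  moreover have "subst s ` X \<subseteq> Fm L'" "subst s \<alpha> \<in> Fm L'"
    using X \<alpha> substitution_Fm[OF s] by auto
  ultimately show "wojcicki L L' S (subst s ` X) (subst s \<alpha>)"
    unfolding wojcicki_def using Z
    by (intro conjI exI[of _ Z] exI[of _ \<beta>] exI[of _ "\<lambda>p. subst s (r p)"])
       (auto simp: subst_subst)
qed

text \<open>The value at an occurring variable is a subformula of the instance.\<close>

lemma Fm_subst_vars:
  assumes "\<alpha> \<in> Fm L" "subst s \<alpha> \<in> Fm L'" "p \<in> vars_of \<alpha>"
  shows "s p \<in> Fm L'"
  using assms
proof (induction)
  case (Fm_App f ts)
  obtain t where t: "t \<in> set ts" "p \<in> vars_of t" using Fm_App.prems by auto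
  have "subst s t \<in> Fm L'"
    using Fm_App.prems(1) t(1) by (auto elim: Fm.cases)
  then show ?case using Fm_App.IH t by blast
qed simp

text \<open>The instances of \<open>Z\<close> and \<open>\<beta>\<close> stay in
  \<open>Fm L\<close>, so the witnessing substitution can be turned into one of \<open>L\<close> and
  structurality of \<open>S\<close> applies. Conversely, the identity substitution is a
  witness.\<close>

lemma wojcicki_conservative:
  assumes ext: "primitive_extension L L'"
    and log: "abstract_logic L S" and str: "structural L S"
    and X: "X \<subseteq> Fm L" and \<alpha>: "\<alpha> \<in> Fm L"
  shows "wojcicki L L' S X \<alpha> \<longleftrightarrow> S X \<alpha>"
proof
  assume "wojcicki L L' S X \<alpha>"
  then obtain Z \<beta> s where Z: "Z \<subseteq> Fm L" "\<beta> \<in> Fm L" "subst s ` Z \<subseteq> X" "\<alpha> = subst s \<beta>" "S Z \<beta>"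
    by (elim wojcickiE)
  \<comment> \<open>\<open>s\<close> is kept only on occurring variables; elsewhere its values may
    lie outside \<open>Fm L\<close>.\<close>
  define r where "r = (\<lambda>p. if p \<in> VarsOf (insert \<beta> Z) then s p else Var p)"
  have "s p \<in> Fm L" if "p \<in> VarsOf (insert \<beta> Z)" for p
    using that Z X \<alpha> Fm_subst_vars[of _ L s L p] unfolding VarsOf_def by blast
  then have "substitution L r" by (auto simp: substitution_def r_def intro: Fm_Var)
  then have "S (subst r ` Z) (subst r \<beta>)" using structuralD[OF str _ Z(1,2,5)] by blast
  moreover have rs: "subst r \<gamma> = subst s \<gamma>" if "\<gamma> \<in> insert \<beta> Z" for \<gamma>
    using that by (intro subst_cong) (auto simp: r_def VarsOf_def)
  then have "subst r ` Z = subst s ` Z" by auto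
  ultimately have "S (subst s ` Z) \<alpha>" using rs Z(4) by simp
  then show "S X \<alpha>" using abstract_logic_mono[OF log X \<alpha> Z(3)] by blast
next
  assume "S X \<alpha>"
  moreover have "substitution L' Var" by (simp add: substitution_def Fm_Var)
  ultimately show "wojcicki L L' S X \<alpha>"
    unfolding wojcicki_def using X \<alpha> primitive_extension_Fm[OF ext]
    by (intro conjI exI[of _ X] exI[of _ \<alpha>] exI[of _ Var]) (auto simp: subst_Var)
qed

lemma wojcicki_instance:
  assumes "Y \<subseteq> Fm L" "\<beta> \<in> Fm L" "S Y \<beta>" "substitution L' s" "X \<subseteq> Fm L'" "subst s ` Y \<subseteq> X"
    "subst s \<beta> \<in> Fm L'"
  shows "wojcicki L L' S X (subst s \<beta>)"
  unfolding wojcicki_def using assms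
  by (intro conjI exI[of _ Y] exI[of _ \<beta>] exI[of _ s]) auto

text \<open>The bound is independent of the number of symbols of \<open>L\<close>, unlike the one for \<open>Z\<close> itself.\<close>

lemma VarsOf_subst_card:
  assumes inf: "infinite (Variables L)" and Z: "Z \<subseteq> Fm L"
  shows "|VarsOf (subst s ` Z)| \<le>o |Variables L|"
proof -
  \<comment> \<open>Every variable of an instance occurs in some \<open>s p\<close> with
    \<open>p\<close> a variable of \<open>L\<close>, and each \<open>s p\<close> has finitely many
    variables.\<close>
  have "VarsOf (subst s ` Z) \<subseteq> VarsOf (s ` Variables L)"
    using VarsOf_subset[OF Z] by (auto simp: VarsOf_def vars_of_subst)
  moreover have "|VarsOf (s ` Variables L)| \<le>o |Variables L|"
    using VarsOf_card[OF inf card_of_image] .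
  ultimately show ?thesis using card_of_mono1 ordLeq_transitive by blast
qed

section \<open>Renaming a derivation into the smaller language\<close>

lemma obtain_renaming:
  fixes L L' :: "('f, 'v) lang"
  assumes inf: "infinite (Variables L)" and sub: "Variables L \<subseteq> Variables L'"
    and U: "U \<subseteq> Variables L'" "|U| \<le>o |Variables L|"
  obtains g h p where "\<And>q. g q \<in> Variables L" "\<And>q. h q \<in> Variables L'" "inj_on g U"
    "\<And>q. q \<in> U \<Longrightarrow> h (g q) = q" "p \<in> Variables L" "p \<notin> g ` U"
proof -
  obtain p where p: "p \<in> Variables L" using infinite_imp_nonempty[OF inf] by blast
  \<comment> \<open>Dropping one element of an infinite set preserves its cardinality, so
    \<open>U\<close> embeds with \<open>p\<close> left free.\<close>
  have "|Variables L| =o |Variables L - {p}|"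
    using infinite_imp_bij_betw[OF inf] card_of_ordIso by metis
  then have "|U| \<le>o |Variables L - {p}|" using U(2) ordLeq_ordIso_trans by blast
  then obtain g where g: "inj_on g U" "g ` U \<subseteq> Variables L - {p}"
    using card_of_ordLeq by metis
  \<comment> \<open>The default \<open>p\<close> makes both maps land among variables everywhere,
    yet \<open>p\<close> stays outside the image of \<open>U\<close>.\<close>
  define g' where "g' q = (if q \<in> U then g q else p)" for q
  define h where "h q = (if q \<in> g ` U then inv_into U g q else p)" for q
  show ?thesis
  proof
    show "g' q \<in> Variables L" for q using g(2) p by (auto simp: g'_def)
    show "h q \<in> Variables L'" for q using U(1) p sub by (auto simp: h_def inv_into_f_f[OF g(1)])
    show "inj_on g' U" using g(1) by (simp add: g'_def inj_on_def)
    show "h (g' q) = q" if "q \<in> U" for q using that g(1) by (simp add: g'_def h_def)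
    show "p \<notin> g' ` U" using g(2) by (auto simp: g'_def)
  qed (fact p)
qed

text \<open>\<open>U\<close> holds the variables of one derivation, \<open>g\<close> moves them into
  \<open>L\<close>, \<open>h\<close> moves them back, and \<open>p\<close> is a spare variable of
  \<open>L\<close> that no renamed formula over \<open>U\<close> contains.\<close>

locale renaming =
  fixes L L' :: "('f, 'v) lang" and U :: "'v set" and g h :: "'v \<Rightarrow> 'v" and p :: 'v
  assumes ext: "primitive_extension L L'"
    and g: "g q \<in> Variables L" and h: "h q \<in> Variables L'" and inj: "inj_on g U"
    and hg: "q \<in> U \<Longrightarrow> h (g q) = q" and p: "p \<in> Variables L" "p \<notin> g ` U"
begin

definition rename :: "('f, 'v) fm \<Rightarrow> ('f, 'v) fm" where
  "rename = subst (\<lambda>q. Var (g q))"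

text \<open>The spare variable is a slot for an arbitrary \<open>\<gamma>\<close>: one substitution
  both restores renamed premises and produces \<open>\<gamma>\<close> from
  \<open>Var p\<close>.\<close>

definition unrename :: "('f, 'v) fm \<Rightarrow> 'v \<Rightarrow> ('f, 'v) fm" where
  "unrename \<gamma> = (\<lambda>q. if q = p then \<gamma> else Var (h q))"

lemma rename_Fm: "\<alpha> \<in> Fm L' \<Longrightarrow> rename \<alpha> \<in> Fm L"
  unfolding rename_def using ext g
  by (intro Fm_subst[of \<alpha> L' L]) (auto simp: primitive_extension_def intro: Fm_Var)

lemma substitution_unrename: "\<gamma> \<in> Fm L' \<Longrightarrow> substitution L' (unrename \<gamma>)"
  using h by (auto simp: substitution_def unrename_def intro: Fm_Var)

lemma unrename_rename:
  assumes "vars_of \<alpha> \<subseteq> U"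
  shows "subst (unrename \<gamma>) (rename \<alpha>) = \<alpha>"
proof -
  have "subst (unrename \<gamma>) (rename \<alpha>) = subst Var \<alpha>"
    unfolding rename_def subst_subst
    using assms p(2) hg by (intro subst_cong) (force simp: unrename_def)
  then show ?thesis by (simp add: subst_Var)
qed

lemma VarsOf_rename_image: "VarsOf (rename ` X) = g ` VarsOf X"
  unfolding rename_def VarsOf_rename ..

lemma wojcicki_unrename:
  assumes "S (rename ` X) (rename \<alpha>)" "X \<subseteq> Fm L'" "\<alpha> \<in> Fm L'" "VarsOf (insert \<alpha> X) \<subseteq> U"
  shows "wojcicki L L' S X \<alpha>"
proof -
  \<comment> \<open>\<open>\<alpha>\<close> is a mere filler at \<open>p\<close>, which occurs in
    none of these renamed formulas.\<close>
  have eq: "subst (unrename \<alpha>) (rename \<delta>) = \<delta>" if "\<delta> \<in> insert \<alpha> X" for \<delta>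
    using that assms(4) by (intro unrename_rename) (auto simp: VarsOf_def)
  then have "subst (unrename \<alpha>) ` rename ` X \<subseteq> X" by (auto simp: image_image)
  then have "wojcicki L L' S X (subst (unrename \<alpha>) (rename \<alpha>))"
    using assms eq rename_Fm by (intro wojcicki_instance substitution_unrename) auto
  then show ?thesis using eq by simp
qed

text \<open>The renamed set proves the spare variable; putting \<open>\<gamma>\<close> for it while
  undoing the renaming derives \<open>\<gamma>\<close> from \<open>X\<close>.\<close>

lemma inconsistent_unrename:
  assumes inc: "\<not> consistent L S (rename ` X)" and X: "X \<subseteq> Fm L'" "VarsOf X \<subseteq> U"
  shows "\<not> consistent L' (wojcicki L L' S) X"
  unfolding inconsistent_iff
proof
  fix \<gamma> assume \<gamma>: "\<gamma> \<in> Fm L'"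
  have pL: "Var p \<in> Fm L" using p(1) by (rule Fm_Var)
  have "S (rename ` X) (Var p)" using inc pL by (simp add: inconsistent_iff)
  moreover have "subst (unrename \<gamma>) (rename \<delta>) = \<delta>" if "\<delta> \<in> X" for \<delta>
    using that X(2) by (intro unrename_rename) (auto simp: VarsOf_def)
  then have "subst (unrename \<gamma>) ` rename ` X \<subseteq> X" by (auto simp: image_image)
  ultimately have "wojcicki L L' S X (subst (unrename \<gamma>) (Var p))"
    using X(1) \<gamma> pL rename_Fm
    by (intro wojcicki_instance substitution_unrename) (auto simp: unrename_def)
  then show "wojcicki L L' S X \<gamma>" by (simp add: unrename_def)
qed

end

section \<open>Uniformity and couniformity of the Wojcicki logic\<close>

lemma structural_into:
  assumes ext: "primitive_extension L L'" and str: "structural L S"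
    and s: "substitution L' s" and t: "\<And>\<delta>. \<delta> \<in> Fm L' \<Longrightarrow> subst t \<delta> \<in> Fm L"
    and S: "Z \<subseteq> Fm L" "\<beta> \<in> Fm L" "S Z \<beta>"
  shows "S (subst t ` subst s ` Z) (subst t (subst s \<beta>))"
proof -
  \<comment> \<open>\<open>s\<close> alone may leave \<open>Fm L\<close>; followed by
    \<open>t\<close> it is a substitution of \<open>L\<close>.\<close>
  have "substitution L (\<lambda>p. subst t (s p))"
    using s t ext by (auto simp: substitution_def primitive_extension_def)
  from structuralD[OF str this S] show ?thesis by (simp add: image_image subst_subst)
qed

text \<open>The premise instances of one derivation are split between \<open>X\<close> and
  \<open>Y\<close> and renamed into \<open>L\<close>; there uniformity of \<open>S\<close> discards
  those from \<open>Y\<close>, and the result is renamed back.\<close>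

lemma uniform_wojcicki:
  fixes L L' :: "('f, 'v) lang"
  assumes inf: "infinite (Variables L)" and ext: "primitive_extension L L'"
    and str: "structural L S" and unif: "uniform_logic L S"
    and log': "abstract_logic L' (wojcicki L L' S)"
  shows "uniform_logic L' (wojcicki L L' S)"
  unfolding uniform_logic_def
proof (intro allI impI)
  fix X Y \<alpha>
  assume X: "X \<subseteq> Fm L'" and Y: "Y \<subseteq> Fm L'" and \<alpha>: "\<alpha> \<in> Fm L'"
    and disj: "VarsOf (X \<union> {\<alpha>}) \<inter> VarsOf Y = {}" and con: "consistent L' (wojcicki L L' S) Y"
    and "wojcicki L L' S (X \<union> Y) \<alpha>"
  then obtain Z \<beta> s where Z: "Z \<subseteq> Fm L" "\<beta> \<in> Fm L" "substitution L' s"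
      "subst s ` Z \<subseteq> X \<union> Y" "\<alpha> = subst s \<beta>" "S Z \<beta>"
    by (elim wojcickiE)
  define X0 where "X0 = X \<inter> subst s ` Z"
  define Y0 where "Y0 = Y \<inter> subst s ` Z"
  \<comment> \<open>The conclusion is included, so that injectivity of \<open>g\<close> also keeps
    its variables apart from those of \<open>Y0\<close>.\<close>
  define U where "U = VarsOf (subst s ` insert \<beta> Z)"
  have sZ: "subst s ` Z = X0 \<union> Y0" using Z(4) by (auto simp: X0_def Y0_def)
  have XY0: "X0 \<subseteq> Fm L'" "Y0 \<subseteq> Fm L'" using X Y by (auto simp: X0_def Y0_def)
  have U_eq: "U = VarsOf (X0 \<union> Y0 \<union> {\<alpha>})" using sZ Z(5) by (simp add: U_def insert_is_Un[of \<alpha>])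
  then have UL': "U \<subseteq> Variables L'" using XY0 \<alpha> by (metis VarsOf_subset Un_least empty_subsetI insert_subset)
  have "|U| \<le>o |Variables L|"
    unfolding U_def using Z(1,2) by (intro VarsOf_subst_card[OF inf]) auto
  then obtain g h p where gh: "\<And>q. g q \<in> Variables L" "\<And>q. h q \<in> Variables L'" "inj_on g U"
      "\<And>q. q \<in> U \<Longrightarrow> h (g q) = q" "p \<in> Variables L" "p \<notin> g ` U"
    using obtain_renaming[OF inf _ UL'] ext unfolding primitive_extension_def by metis
  interpret renaming L L' U g h p using ext gh by unfold_locales
  have U: "VarsOf (insert \<alpha> X0) \<subseteq> U" "VarsOf Y0 \<subseteq> U"
    unfolding U_eq by (auto intro!: VarsOf_mono)
  have "S (rename ` (X0 \<union> Y0)) (rename \<alpha>)"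
    unfolding sZ[symmetric] Z(5) rename_def
    using rename_Fm Z by (intro structural_into[OF ext str]) (auto simp: rename_def)
  \<comment> \<open>Otherwise inconsistency would pass back to \<open>Y0\<close> and, by
    monotonicity, to \<open>Y\<close>.\<close>
  moreover have "consistent L S (rename ` Y0)"
    using inconsistent_unrename[OF _ XY0(2) U(2)] consistent_subset[OF log' Y con, of Y0]
    by (auto simp: Y0_def)
  moreover have "VarsOf (insert \<alpha> X0) \<inter> VarsOf Y0 = {}"
    using disj unfolding X0_def Y0_def VarsOf_def by blast
  then have "VarsOf (rename ` insert \<alpha> X0) \<inter> VarsOf (rename ` Y0) = {}"
    unfolding VarsOf_rename_image inj_on_image_Int[OF inj U, symmetric] by simp
  ultimately have "S (rename ` X0) (rename \<alpha>)"
    using unif[unfolded uniform_logic_def, rule_format, of "rename ` X0" "rename ` Y0" "rename \<alpha>"]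
      XY0 \<alpha> rename_Fm by (auto simp: image_Un)
  then have "wojcicki L L' S X0 \<alpha>" using wojcicki_unrename[OF _ XY0(1) \<alpha> U(1)] by blast
  then show "wojcicki L L' S X \<alpha>"
    by (rule abstract_logic_mono[OF log' X \<alpha>, rotated]) (simp add: X0_def)
qed

text \<open>A derivation of a variable absent from the family yields an inconsistent renamed family
  in \<open>L\<close>; couniformity of \<open>S\<close> picks a guilty member, which is renamed
  back.\<close>

lemma couniform_wojcicki:
  fixes L L' :: "('f, 'v) lang"
  assumes inf: "infinite (Variables L)" and ext: "primitive_extension L L'"
    and str: "structural L S" and counif: "couniform_logic L S"
    and log': "abstract_logic L' (wojcicki L L' S)"
  shows "couniform_logic L' (wojcicki L L' S)"
  unfolding couniform_logic_def
proof (intro allI impI)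
  fix XX
  assume sep: "separated L' XX" and inc: "\<not> consistent L' (wojcicki L L' S) (\<Union>XX)"
  have XX: "X \<subseteq> Fm L'" if "X \<in> XX" for X using sep that by (simp add: separated_def)
  have "VarsOf (\<Union>XX) \<subseteq> Variables L'" using XX by (intro VarsOf_subset Union_least)
  then obtain q where q: "q \<in> Variables L'" "q \<notin> VarsOf (\<Union>XX)"
    using sep by (auto simp: separated_def)
  have "wojcicki L L' S (\<Union>XX) (Var q)"
    using inc[unfolded inconsistent_iff] Fm_Var[OF q(1)] by (rule bspec)
  then obtain Z \<beta> s where Z: "Z \<subseteq> Fm L" "\<beta> \<in> Fm L" "substitution L' s"
      "subst s ` Z \<subseteq> \<Union>XX" "Var q = subst s \<beta>" "S Z \<beta>"
    by (elim wojcickiE)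
  \<comment> \<open>Substitution preserves the head symbol of a compound formula, so only a variable
    can become \<open>Var q\<close>.\<close>
  obtain b where b: "\<beta> = Var b" "s b = Var q" using Z(5) by (cases \<beta>) auto
  have bZ: "b \<notin> VarsOf Z"
  proof
    assume "b \<in> VarsOf Z"
    then have "q \<in> VarsOf (subst s ` Z)" using b(2) by (force simp: VarsOf_def vars_of_subst)
    then show False using VarsOf_mono[OF Z(4)] q(2) by blast
  qed
  \<comment> \<open>Premises only: the conclusion \<open>Var q\<close> is to be replaced by
    arbitrary formulas.\<close>
  define U where "U = VarsOf (subst s ` Z)"
  have UL': "U \<subseteq> Variables L'"
    unfolding U_def using VarsOf_mono[OF Z(4)] \<open>VarsOf (\<Union>XX) \<subseteq> Variables L'\<close> by (rule subset_trans)
  have "|U| \<le>o |Variables L|"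
    unfolding U_def using Z(1) by (intro VarsOf_subst_card[OF inf])
  then obtain g h p where gh: "\<And>q. g q \<in> Variables L" "\<And>q. h q \<in> Variables L'" "inj_on g U"
      "\<And>q. q \<in> U \<Longrightarrow> h (g q) = q" "p \<in> Variables L" "p \<notin> g ` U"
    using obtain_renaming[OF inf _ UL'] ext unfolding primitive_extension_def by metis
  interpret renaming L L' U g h p using ext gh by unfold_locales
  \<comment> \<open>Each member is cut down to the premises actually used, whose variables fit into
    \<open>U\<close>.\<close>
  define YY where "YY = (\<lambda>X. rename ` (X \<inter> subst s ` Z)) ` XX"
  have "subst s ` Z = (\<Union>X\<in>XX. X \<inter> subst s ` Z)" using Z(4) by blast
  then have YY_Un: "\<Union>YY = rename ` subst s ` Z" unfolding YY_def by (metis image_UN)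
  have "\<not> consistent L S (\<Union>YY)"
    unfolding inconsistent_iff
  proof
    fix \<gamma> assume \<gamma>: "\<gamma> \<in> Fm L"
    \<comment> \<open>As \<open>b\<close> is absent from \<open>Z\<close>, its value can be changed
      to \<open>\<gamma>\<close> without affecting the renamed premises.\<close>
    define r where "r = (\<lambda>a. if a = b then \<gamma> else rename (s a))"
    have "substitution L r"
      using Z(3) \<gamma> rename_Fm ext by (auto simp: substitution_def primitive_extension_def r_def)
    from structuralD[OF str this Z(1,2,6)] have "S (subst r ` Z) \<gamma>" by (simp add: b r_def)
    moreover have "subst r z = rename (subst s z)" if "z \<in> Z" for z
      unfolding rename_def subst_subst using that bZ
      by (intro subst_cong) (auto simp: r_def rename_def VarsOf_def)
    then have "subst r ` Z = \<Union>YY" unfolding YY_Un by (simp add: image_image)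
    ultimately show "S (\<Union>YY) \<gamma>" by simp
  qed
  moreover have "separated L YY"
    unfolding separated_def
  proof (intro conjI ballI impI)
    show "Y \<subseteq> Fm L" if "Y \<in> YY" for Y using that XX rename_Fm by (auto simp: YY_def)
    show "VarsOf Y \<inter> VarsOf Y' = {}" if Y: "Y \<in> YY" "Y' \<in> YY" "Y \<noteq> Y'" for Y Y'
    proof -
      \<comment> \<open>Distinct images come from distinct members of \<open>XX\<close>.\<close>
      obtain X X' where X: "X \<in> XX" "X' \<in> XX" "X \<noteq> X'" "Y = rename ` (X \<inter> subst s ` Z)"
          "Y' = rename ` (X' \<inter> subst s ` Z)"
        using Y unfolding YY_def by blast
      have "VarsOf X \<inter> VarsOf X' = {}" using sep X by (simp add: separated_def)
      then have "VarsOf (X \<inter> subst s ` Z) \<inter> VarsOf (X' \<inter> subst s ` Z) = {}"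
        unfolding VarsOf_def by blast
      moreover have "VarsOf (X \<inter> subst s ` Z) \<subseteq> U" "VarsOf (X' \<inter> subst s ` Z) \<subseteq> U"
        by (auto simp: U_def intro!: VarsOf_mono)
      ultimately show ?thesis
        unfolding X VarsOf_rename_image using inj_on_image_Int[OF inj] by (metis image_empty)
    qed
    \<comment> \<open>The spare variable \<open>p\<close> is the one that the renamed family
      avoids.\<close>
    have "VarsOf (\<Union>YY) = g ` U" unfolding YY_Un VarsOf_rename_image U_def ..
    then show "VarsOf (\<Union>YY) \<noteq> Variables L" using p by blast
  qed
  ultimately obtain X where X: "X \<in> XX" "\<not> consistent L S (rename ` (X \<inter> subst s ` Z))"
    using counif unfolding couniform_logic_def YY_def by blast
  have "\<not> consistent L' (wojcicki L L' S) (X \<inter> subst s ` Z)"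
    using XX[OF X(1)] by (intro inconsistent_unrename X(2)) (auto simp: U_def intro!: VarsOf_mono)
  then show "\<exists>X\<in>XX. \<not> consistent L' (wojcicki L L' S) X"
    using consistent_subset[OF log' XX[OF X(1)], of "X \<inter> subst s ` Z"] X(1) by blast
qed

theorem proposition4p3:
  fixes L L' :: "('f, 'v) lang" and S :: "('f, 'v) conseq"
  assumes "language L" and "infinite (Variables L)"
    and "primitive_extension L L'"
    and "abstract_logic L S" and "structural L S"
    and "uniform_logic L S" and "couniform_logic L S"
    and "abstract_logic L' (wojcicki L L' S)"
  shows "\<exists>\<A> :: ('f, ('f, 'v) fm, ('f, 'v) fm set) atlas.
    is_atlas L \<A> \<and>
    determined_by L S \<A> \<and> determined_by L' (wojcicki L L' S) \<A> \<and>
    uniform_atlas L \<A> \<and> couniform_atlas L \<A> \<and>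
    uniform_atlas L' \<A> \<and> couniform_atlas L' \<A>"
proof -
  let ?W = "wojcicki L L' S"
  have th: "(\<Union>i\<in>Index (lindenbaum L' ?W). SS L (lindenbaum L' ?W) i) = theories L S"
    using SS_lindenbaum[OF assms(3,8) structural_wojcicki wojcicki_conservative[OF assms(3-5)]] .
  \<comment> \<open>The same lemma now serves \<open>L'\<close>, taken as its own extension, with
    the Wojcicki logic compared to itself.\<close>
  have "primitive_extension L' L'"
    using assms(3) primitive_extension_refl by (auto simp: primitive_extension_def)
  then have th': "(\<Union>i\<in>Index (lindenbaum L' ?W). SS L' (lindenbaum L' ?W) i) = theories L' ?W"
    using SS_lindenbaum[OF _ assms(8) structural_wojcicki] by blast
  have "Variables L' \<noteq> {}"
    using assms(2,3) by (auto simp: primitive_extension_def)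
  then show ?thesis
    using is_atlas_lindenbaum[OF assms(3)]
      determined_by_theories[OF assms(4) th] determined_by_theories[OF assms(8) th']
      uniform_atlas_theories[OF assms(4) th assms(6)]
      couniform_atlas_theories[OF assms(4) th assms(7)]
      uniform_atlas_theories[OF assms(8) th' uniform_wojcicki[OF assms(2,3,5,6,8)]]
      couniform_atlas_theories[OF assms(8) th' couniform_wojcicki[OF assms(2,3,5,7,8)]]
    by blast
qed

end
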